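(* Suppose that European put options with maturity $T$ are traded at time $0$ at prices $E(K)$, $K\ge 0$, where $E$ satisfies: (1) $E$ is increasing and convex with $E(0)=0$; (2) $E(K)\ge (e^{-rT}K-S_0)_+$ for all $K\ge 0$; (3) $E(K)\le e^{-rT}K$ for all $K\ge 0$; (4) for any $K\ge0$ with $E(K)>e^{-rT}K-S_0$ we have $E'(K+)<e^{-rT}$. Suppose also that American put options with the same maturity $T$ are traded at time $0$ at prices $A(K)$, $K\ge 0$. If $A$ is an arbitrage-free American put price function (i.e. there is no model-independent arbitrage in the market consisting of cash, the underlying, the European puts and the American puts), then: (i) $A$ is increasing and convex in $K$. (ii) For any $K\ge 0$, $$A'(K+)K-A(K)\ \ge\ E'(K+)K-E(K).$$ (iii) $A(K)\ge \max\{E(K),K-S_0\}$ for all $K\ge 0$. (iv) $A(K)\le E(e^{rT}K)$ for all $K\ge0$.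
   Context: Market: an underlying asset with price process $(S_t)_{0\le t\le T}$ (non-negative, not paying dividends, current price $S_0$) can be traded frictionlessly; cash accrues interest at a constant rate $r>0$; put options on the underlying with common maturity $T$ can be bought and sold, at the given prices, at time $0$ only. The European put with strike $K$ pays $(K-S_T)_+$ at time $T$; the American put with strike $K$ can be exercised by its holder at any time $\tau\in[0,T]$ of the holder's choice, then paying $K-S_\tau$ (it need not be exercised). No probability measure or model for $S$ is specified. A portfolio is semi-static if it consists of a position in the options fixed at time $0$ and a position in the underlying (and cash) that is altered only finitely many times by a self-financing strategy. American options held short are exercised at a time chosen by the counterparty; American options held long may be exercised by the portfolio holder at any time, in particular at the moment when the counterparty exercises a short position. There is model-independent arbitrage if there is a semi-static portfolio with strictly negative initial value and only non-negative subsequent cashflows, whatever the evolution of the underlying and whatever the exercise decisions of the counterparties. "Increasing" means non-decreasing; $f'(K+)$ denotes the right derivative; $x_+=\max\{x,0\}$. *)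

theory Defs
  imports "HOL-Analysis.Analysis"
begin

definition right_deriv :: "(real \<Rightarrow> real) \<Rightarrow> real \<Rightarrow> real" where
  "right_deriv f x = (THE D. (f has_real_derivative D) (at_right x))"

(* A scenario is one evolution of the underlying together with one set of exercise decisions of
   the counterparties: called w K t is the number of short American puts with strike K that the
   counterparties exercise at time t.  Only times in {0..T} matter. *)
record scenario =
  price :: "real \<Rightarrow> real"
  called :: "real \<Rightarrow> real \<Rightarrow> real"

(* Option positions are numbers of contracts per strike.  Long and short American positions are
   kept apart, since their exercise is decided by different parties.  The last three fields are
   the dynamic part: the number of shares bought, the amount paid into the cash account
   (negative: borrowed), and the number of long American puts with a given strike exercised, at
   a given time. *)
record portfolio =
  european :: "real \<Rightarrow> real"
  am_long :: "real \<Rightarrow> real"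
  am_short :: "real \<Rightarrow> real"
  shares :: real
  cash :: real
  buy :: "scenario \<Rightarrow> real \<Rightarrow> real"
  deposit :: "scenario \<Rightarrow> real \<Rightarrow> real"
  exercise :: "scenario \<Rightarrow> real \<Rightarrow> real \<Rightarrow> real"

definition positions :: "(real \<Rightarrow> real) \<Rightarrow> real set" where
  "positions q = {K. q K \<noteq> 0}"

definition dates :: "real \<Rightarrow> (real \<Rightarrow> real) \<Rightarrow> real set" where
  "dates T x = {t \<in> {0..T}. x t \<noteq> 0}"

(* Each contract is exercised at most once, possibly never; different contracts with the same
   strike may be exercised at different times. *)
definition exercise_plan :: "real \<Rightarrow> (real \<Rightarrow> real) \<Rightarrow> (real \<Rightarrow> real \<Rightarrow> real) \<Rightarrow> bool" where
  "exercise_plan T q x \<longleftrightarrow>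
     (\<forall>K. (\<forall>t\<in>{0..T}. x K t \<ge> 0) \<and> finite (dates T (x K)) \<and> (\<Sum>t\<in>dates T (x K). x K t) \<le> q K)"

definition scenarios :: "real \<Rightarrow> real \<Rightarrow> portfolio \<Rightarrow> scenario set" where
  "scenarios T S0 P =
     {w. price w 0 = S0 \<and> (\<forall>t\<in>{0..T}. price w t \<ge> 0) \<and> exercise_plan T (am_short P) (called w)}"

(* Time t is included: the holder may react to an exercise at the very moment it takes place. *)
definition same_until :: "real \<Rightarrow> scenario \<Rightarrow> scenario \<Rightarrow> bool" where
  "same_until t w w' \<longleftrightarrow>
     (\<forall>u\<in>{0..t}. price w u = price w' u \<and> (\<forall>K. called w K u = called w' K u))"

definition nonanticipating :: "real \<Rightarrow> scenario set \<Rightarrow> (scenario \<Rightarrow> real \<Rightarrow> real) \<Rightarrow> bool" where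
  "nonanticipating T W F \<longleftrightarrow>
     (\<forall>w\<in>W. \<forall>w'\<in>W. \<forall>t\<in>{0..T}. same_until t w w' \<longrightarrow> F w t = F w' t)"

definition semi_static :: "real \<Rightarrow> real \<Rightarrow> portfolio \<Rightarrow> bool" where
  "semi_static T S0 P \<longleftrightarrow>
     (\<forall>q\<in>{european P, am_long P, am_short P}. finite (positions q) \<and> positions q \<subseteq> {0..}) \<and>
     (\<forall>K. am_long P K \<ge> 0 \<and> am_short P K \<ge> 0) \<and>
     nonanticipating T (scenarios T S0 P) (buy P) \<and>
     nonanticipating T (scenarios T S0 P) (deposit P) \<and>
     (\<forall>K. nonanticipating T (scenarios T S0 P) (\<lambda>w. exercise P w K)) \<and>
     (\<forall>w\<in>scenarios T S0 P.
        finite (dates T (buy P w)) \<and> finite (dates T (deposit P w)) \<and>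
        exercise_plan T (am_long P) (exercise P w))"

definition initial_value ::
  "real \<Rightarrow> (real \<Rightarrow> real) \<Rightarrow> (real \<Rightarrow> real) \<Rightarrow> portfolio \<Rightarrow> real" where
  "initial_value S0 E A P =
     (\<Sum>K\<in>positions (european P). european P K * E K)
     + (\<Sum>K\<in>positions (am_long P). am_long P K * A K)
     - (\<Sum>K\<in>positions (am_short P). am_short P K * A K)
     + shares P * S0 + cash P"

definition exercise_cashflow :: "portfolio \<Rightarrow> scenario \<Rightarrow> real \<Rightarrow> real" where
  "exercise_cashflow P w t =
     (\<Sum>K\<in>positions (am_long P). exercise P w K t * (K - price w t))
     - (\<Sum>K\<in>positions (am_short P). called w K t * (K - price w t))"

definition final_shares :: "real \<Rightarrow> portfolio \<Rightarrow> scenario \<Rightarrow> real" where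
  "final_shares T P w = shares P + (\<Sum>t\<in>dates T (buy P w). buy P w t)"

definition final_cash :: "real \<Rightarrow> real \<Rightarrow> portfolio \<Rightarrow> scenario \<Rightarrow> real" where
  "final_cash r T P w =
     exp (r * T) * cash P + (\<Sum>t\<in>dates T (deposit P w). exp (r * (T - t)) * deposit P w t)"

definition terminal_value :: "real \<Rightarrow> real \<Rightarrow> portfolio \<Rightarrow> scenario \<Rightarrow> real" where
  "terminal_value r T P w =
     (\<Sum>K\<in>positions (european P). european P K * max (K - price w T) 0)
     + final_shares T P w * price w T + final_cash r T P w"

(* The budget equation of the strategy: what the exercised options pay at time t, less what is
   spent on shares and put into the cash account, is paid out to the holder; at T the portfolio
   is liquidated as well.  Trading is self-financing because an arbitrage is only allowed
   non-negative payouts, so external funds never enter; payout 0 before T is strict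
   self-financing, with all option payoffs settled through the cash account.
   Cashflows at time 0 are those that arise after the portfolio has been set up. *)
definition cashflow :: "real \<Rightarrow> real \<Rightarrow> portfolio \<Rightarrow> scenario \<Rightarrow> real \<Rightarrow> real" where
  "cashflow r T P w t =
     exercise_cashflow P w t - buy P w t * price w t - deposit P w t
     + (if t = T then terminal_value r T P w else 0)"

definition model_independent_arbitrage ::
  "real \<Rightarrow> real \<Rightarrow> real \<Rightarrow> (real \<Rightarrow> real) \<Rightarrow> (real \<Rightarrow> real) \<Rightarrow> bool" where
  "model_independent_arbitrage r T S0 E A \<longleftrightarrow>
     (\<exists>P. semi_static T S0 P \<and> initial_value S0 E A P < 0 \<and>
          (\<forall>w\<in>scenarios T S0 P. \<forall>t\<in>{0..T}. cashflow r T P w t \<ge> 0))"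

end

(* Short American puts are superhedged by long ones that are exercised, in proportion, at the
   moment the counterparty exercises.  For (ii) one
   sells K + h American puts with strike K and K European puts with strike K + h, and buys
   K American puts with strike K + h and K + h European puts with strike K.  An early exercise then
   yields h / (K + h) shares per exercised put at no cost, and these shares cover the terminal
   shortfall.  So K A(K + h) - (K + h) A(K) >= K E(K + h) - (K + h) E(K) for all h > 0; divide by h
   and let h tend to 0. *)
theory Submission imports Defs begin

section \<open>Right derivatives of convex functions\<close>

text \<open>By convexity the slopes of chords from \<open>x\<close> decrease as the right endpoint
  moves down to \<open>x\<close>, and monotonicity bounds them below by 0, so they converge to their
  infimum. This bound also serves at the endpoint \<open>a\<close>, where no chord on the left is
  available.\<close>

lemma convex_on_right_derivative:
  fixes f :: "real \<Rightarrow> real"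
  assumes conv: "convex_on {a..} f" and mono: "mono_on {a..} f" and x: "a \<le> x"
  shows "(f has_real_derivative right_deriv f x) (at_right x)"
proof -
  define s where "s y = (f y - f x) / (y - x)" for y
  have s_nonneg: "0 \<le> s y" if "x < y" for y
    using that x mono unfolding s_def by (auto intro!: divide_nonneg_pos simp: mono_on_def)
  have s_mono: "s t \<le> s y" if "x < t" "t < y" for t y
  proof -
    have "s u = (f x - f u) / (x - u)" for u
      unfolding s_def by (metis minus_diff_eq minus_divide_divide)
    then show ?thesis
      using convex_on_slope_le(1)[OF conv, of x y t] that x by simp
  qed
  have bdd: "bdd_below (s ` {x<..})"
    using s_nonneg by (auto intro!: bdd_belowI)
  have "(s \<longlongrightarrow> Inf (s ` {x<..})) (at_right x)"
  proof (rule order_tendstoI)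
    fix c assume "c < Inf (s ` {x<..})"
    moreover have "Inf (s ` {x<..}) \<le> s y" if "x < y" for y
      using that bdd by (auto intro: cInf_lower)
    ultimately show "\<forall>\<^sub>F y in at_right x. c < s y"
      by (intro eventually_mono[OF eventually_at_right_less]) (rule less_le_trans)
  next
    fix c assume "Inf (s ` {x<..}) < c"
    then obtain y where "x < y" "s y < c"
      using cInf_lessD[of "s ` {x<..}" c] by auto
    then show "\<forall>\<^sub>F t in at_right x. s t < c"
      using s_mono by (force simp: eventually_at_right_field)
  qed
  then have "(f has_real_derivative Inf (s ` {x<..})) (at_right x)"
    by (simp add: has_field_derivative_iff s_def[abs_def])
  then show ?thesis
    unfolding right_deriv_def
    by (rule theI) (use \<open>(f has_real_derivative _) _\<close> in
      \<open>auto intro: has_field_derivative_unique simp: trivial_limit_at_right_real\<close>)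
qed

section \<open>Sums over supports, and exercise plans\<close>

text \<open>A process built from others may vanish at some of their dates; passing to a common
  finite set allows sums to be split and compared.\<close>

lemma sum_dates_mono_neutral:
  assumes "finite D" "dates T x \<subseteq> D" "D \<subseteq> {0..T}" "\<And>t. x t = 0 \<Longrightarrow> g t = 0"
  shows "sum g (dates T x) = sum g D"
  using assms by (intro sum.mono_neutral_left) (auto simp: dates_def)

lemma sum_positions_mono_neutral:
  assumes "finite F" "positions q \<subseteq> F" "\<And>K. q K = 0 \<Longrightarrow> g K = 0"
  shows "sum g (positions q) = sum g F"
  using assms by (intro sum.mono_neutral_left) (auto simp: positions_def)

text \<open>Non-negative numbers with sum at most 0 vanish. Hence exercise cashflows over
  \<open>positions\<close> can be summed over a larger fixed set of strikes.\<close>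

lemma exercise_plan_unheld:
  assumes plan: "exercise_plan T q x" and "q K = 0" and t: "t \<in> {0..T}"
  shows "x K t = 0"
proof (rule ccontr)
  assume "x K t \<noteq> 0"
  then have "x K t \<le> (\<Sum>u\<in>dates T (x K). x K u)"
    using plan t by (intro member_le_sum) (auto simp: exercise_plan_def dates_def)
  also have "\<dots> \<le> 0"
    using plan \<open>q K = 0\<close> by (metis exercise_plan_def)
  finally have "x K t \<le> 0" .
  moreover have "0 \<le> x K t"
    using plan t by (simp add: exercise_plan_def)
  ultimately show False
    using \<open>x K t \<noteq> 0\<close> by simp
qed

text \<open>Makes exercise at \<open>T\<close> nonanticipating although it depends on the total
  number of calls.\<close>

lemma same_until_sum_called:
  assumes "same_until T w w'"
  shows "(\<Sum>t\<in>dates T (called w K). called w K t) = (\<Sum>t\<in>dates T (called w' K). called w' K t)"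
  using assms by (auto simp: same_until_def dates_def intro!: sum.cong)

section \<open>Superhedging short American puts\<close>

text \<open>The hedge of \<^term>\<open>n\<close> short puts: whenever the counterparty exercises \<^term>\<open>c\<close> of them,
  exercise \<^term>\<open>c * x L\<close> of the long puts with strike \<^term>\<open>L\<close>, buy \<^term>\<open>c * b\<close> shares and
  borrow \<^term>\<open>- c * d\<close>; the remaining long puts are exercised at \<^term>\<open>T\<close> if in the money.
  In the terminal condition \<^term>\<open>\<theta>\<close> is the number of short puts that have been exercised, and
  the debt is bounded as if it had all been taken up at time 0.\<close>

lemma superhedge:
  fixes r T S0 n K b d :: real and E A q l x :: "real \<Rightarrow> real"
  assumes r: "0 \<le> r" and T: "0 \<le> T"
    and no_arb: "\<not> model_independent_arbitrage r T S0 E A"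
    and F: "finite F" "F \<subseteq> {0..}" and K: "0 \<le> K" and n: "0 \<le> n" and d: "d \<le> 0"
    and x: "\<And>L. L \<in> F \<Longrightarrow> 0 \<le> x L" "\<And>L. L \<in> F \<Longrightarrow> n * x L \<le> l L"
    and call: "\<And>S. 0 \<le> S \<Longrightarrow> (K - S) + b * S + d \<le> (\<Sum>L\<in>F. x L * (L - S))"
    and final: "\<And>S \<theta>. 0 \<le> S \<Longrightarrow> 0 \<le> \<theta> \<Longrightarrow> \<theta> \<le> n \<Longrightarrow>
      0 \<le> (\<Sum>L\<in>F. (q L + l L - \<theta> * x L) * max (L - S) 0) + \<theta> * b * S + \<theta> * d * exp (r * T)"
  shows "n * A K \<le> (\<Sum>L\<in>F. q L * E L + l L * A L)"
proof (rule ccontr)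
  assume neg: "\<not> ?thesis"
  define C where "C w = (\<Sum>t\<in>dates T (called w K). called w K t)" for w :: scenario
  \<comment> \<open>The \<open>C w * x L\<close> puts exercised alongside the calls are gone at
    \<open>T\<close>; the others are exercised there only if in the money. \<open>C w\<close> looks
    at all of [0, T], which is harmless because \<open>rest\<close> enters the strategy only at
    \<open>T\<close>.\<close>
  define rest where "rest w L = (if price w T < L then l L - C w * x L else 0)" for w :: scenario and L
  define P where "P = \<lparr>european = (\<lambda>L. if L \<in> F then q L else 0),
    am_long = (\<lambda>L. if L \<in> F then l L else 0),
    am_short = (\<lambda>L. if L = K then n else 0), shares = 0, cash = 0,
    buy = (\<lambda>w t. b * called w K t), deposit = (\<lambda>w t. d * called w K t),
    exercise = (\<lambda>w L t. if L \<in> F then x L * called w K t + (if t = T then rest w L else 0) else 0)\<rparr>"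
  have [simp]: "european P = (\<lambda>L. if L \<in> F then q L else 0)"
    "am_long P = (\<lambda>L. if L \<in> F then l L else 0)"
    "am_short P = (\<lambda>L. if L = K then n else 0)" "shares P = 0" "cash P = 0"
    "buy P = (\<lambda>w t. b * called w K t)" "deposit P = (\<lambda>w t. d * called w K t)"
    "exercise P = (\<lambda>w L t. if L \<in> F then x L * called w K t + (if t = T then rest w L else 0) else 0)"
    by (simp_all add: P_def)
  have pos: "positions (european P) \<subseteq> F" "positions (am_long P) \<subseteq> F"
    "positions (am_short P) \<subseteq> {K}"
    by (auto simp: positions_def split: if_splits)
  have l: "0 \<le> l L" if "L \<in> F" for L
    using x[OF that] n by (meson mult_nonneg_nonneg order_trans)
  have calls: "0 \<le> called w K t" "finite (dates T (called w K))" "0 \<le> C w" "C w \<le> n"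
    if "w \<in> scenarios T S0 P" "t \<in> {0..T}" for w t
  proof -
    have plan: "exercise_plan T (am_short P) (called w)"
      using that by (simp add: scenarios_def)
    then show "0 \<le> called w K t" "finite (dates T (called w K))"
      using that by (auto simp: exercise_plan_def)
    show "0 \<le> C w"
      using plan unfolding C_def by (intro sum_nonneg) (auto simp: exercise_plan_def dates_def)
    show "C w \<le> n"
      using plan by (auto simp: exercise_plan_def C_def dest: spec[of _ K])
  qed
  have rest: "0 \<le> rest w L" "C w * x L + rest w L \<le> l L"
    if "w \<in> scenarios T S0 P" "L \<in> F" for w L
  proof -
    have "C w * x L \<le> n * x L"
      using calls[OF that(1), of T] x(1)[OF that(2)] T by (intro mult_right_mono) auto
    also have "\<dots> \<le> l L"
      using x that by auto
    finally show "0 \<le> rest w L" "C w * x L + rest w L \<le> l L"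
      by (auto simp: rest_def)
  qed
  have plan: "exercise_plan T (am_long P) (exercise P w)" if w: "w \<in> scenarios T S0 P" for w
    unfolding exercise_plan_def
  proof (intro allI conjI ballI)
    fix L
    show "0 \<le> exercise P w L t" if "t \<in> {0..T}" for t
      using calls[OF w that] rest[OF w] x by auto
    \<comment> \<open>\<open>T\<close> is added because the remaining puts may be exercised there
      without a call.\<close>
    define D where "D = insert T (dates T (called w K))"
    have D: "finite D" "D \<subseteq> {0..T}" "dates T (exercise P w L) \<subseteq> D"
      using calls(2)[OF w, of T] T by (auto simp: D_def dates_def split: if_splits)
    then show "finite (dates T (exercise P w L))"
      by (auto intro: finite_subset)
    have "(\<Sum>t\<in>dates T (exercise P w L). exercise P w L t) = (\<Sum>t\<in>D. exercise P w L t)"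
      by (rule sum_dates_mono_neutral) (use D in auto)
    also have "\<dots> = (if L \<in> F then x L * (\<Sum>t\<in>D. called w K t) + rest w L else 0)"
      using D(1) by (simp add: sum.distrib sum_distrib_left D_def)
    also have "(\<Sum>t\<in>D. called w K t) = C w"
      unfolding C_def by (rule sum_dates_mono_neutral[symmetric]) (use D in \<open>auto simp: D_def\<close>)
    also have "(if L \<in> F then x L * C w + rest w L else 0) \<le> am_long P L"
      using rest[OF w] by (simp add: mult.commute)
    finally show "(\<Sum>t\<in>dates T (exercise P w L). exercise P w L t) \<le> am_long P L" .
  qed
  have "semi_static T S0 P"
    unfolding semi_static_def
  proof (intro conjI ballI allI)
    show "finite (positions p)" "positions p \<subseteq> {0..}"
      if "p \<in> {european P, am_long P, am_short P}" for p
      using that pos F K by (auto intro: finite_subset)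
    show "0 \<le> am_long P L" "0 \<le> am_short P L" for L
      using l n by auto
    show "nonanticipating T (scenarios T S0 P) (buy P)"
      "nonanticipating T (scenarios T S0 P) (deposit P)"
      by (auto simp: nonanticipating_def same_until_def)
    show "nonanticipating T (scenarios T S0 P) (\<lambda>w. exercise P w L)" for L
      unfolding nonanticipating_def
    proof (intro ballI impI)
      fix w w' t
      assume "t \<in> {0..T}" and same: "same_until t w w'"
      moreover have "rest w L = rest w' L" if "t = T"
        using same same_until_sum_called[of T w w'] that T by (auto simp: rest_def C_def same_until_def)
      ultimately show "exercise P w L t = exercise P w' L t"
        by (auto simp: same_until_def)
    qed
    fix w assume w: "w \<in> scenarios T S0 P"
    show "exercise_plan T (am_long P) (exercise P w)"
      by (rule plan[OF w])
    show "finite (dates T (buy P w))" "finite (dates T (deposit P w))"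
      using calls(2)[OF w, of T] T by (auto elim!: rev_finite_subset simp: dates_def)
  qed
  moreover have "initial_value S0 E A P < 0"
  proof -
    have "(\<Sum>L\<in>positions (european P). european P L * E L) = (\<Sum>L\<in>F. european P L * E L)"
      "(\<Sum>L\<in>positions (am_long P). am_long P L * A L) = (\<Sum>L\<in>F. am_long P L * A L)"
      "(\<Sum>L\<in>positions (am_short P). am_short P L * A L) = (\<Sum>L\<in>{K}. am_short P L * A L)"
      by (rule sum_positions_mono_neutral; use pos F in simp)+
    then show ?thesis
      using neg by (simp add: initial_value_def sum.distrib)
  qed
  moreover have "0 \<le> cashflow r T P w t" if w: "w \<in> scenarios T S0 P" and t: "t \<in> {0..T}" for w t
  proof -
    let ?S = "price w t" and ?c = "called w K t"
    have S: "0 \<le> ?S"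
      using w t by (simp add: scenarios_def)
    have "(\<Sum>L\<in>positions (am_long P). exercise P w L t * (L - ?S)) =
        (\<Sum>L\<in>F. exercise P w L t * (L - ?S))"
      by (rule sum_positions_mono_neutral[OF F(1) pos(2)])
        (use exercise_plan_unheld[OF plan[OF w] _ t] in simp)
    also have "\<dots> = (\<Sum>L\<in>F. ?c * (x L * (L - ?S)) + (if t = T then rest w L * (L - ?S) else 0))"
      by (rule sum.cong) (auto simp: algebra_simps)
    also have "\<dots> = ?c * (\<Sum>L\<in>F. x L * (L - ?S))
        + (if t = T then \<Sum>L\<in>F. rest w L * (L - ?S) else 0)"
      by (simp add: sum.distrib sum_distrib_left)
    finally have "(\<Sum>L\<in>positions (am_long P). exercise P w L t * (L - ?S)) =
        ?c * (\<Sum>L\<in>F. x L * (L - ?S)) + (if t = T then \<Sum>L\<in>F. rest w L * (L - ?S) else 0)" .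
    moreover have "(\<Sum>L\<in>positions (am_short P). called w L t * (L - ?S)) =
        (\<Sum>L\<in>{K}. called w L t * (L - ?S))"
      by (rule sum_positions_mono_neutral[OF _ pos(3)])
        (use exercise_plan_unheld[of T "am_short P" "called w", OF _ _ t] w in \<open>auto simp: scenarios_def\<close>)
    ultimately have ex: "exercise_cashflow P w t =
        ?c * ((\<Sum>L\<in>F. x L * (L - ?S)) - (K - ?S))
        + (if t = T then \<Sum>L\<in>F. rest w L * (L - ?S) else 0)"
      unfolding exercise_cashflow_def by (simp add: right_diff_distrib)
    \<comment> \<open>Exercise only in the money gives the remaining American puts the payoff of
      European ones, as in \<open>final\<close>.\<close>
    have rest_payoff: "rest w L * (L - price w T) = (l L - C w * x L) * max (L - price w T) 0" for L
      by (auto simp: rest_def)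
    have D: "finite (dates T (called w K))" "dates T (called w K) \<subseteq> {0..T}"
      using calls(2)[OF w t] by (auto simp: dates_def)
    have shares: "final_shares T P w = C w * b"
    proof -
      have "(\<Sum>t\<in>dates T (buy P w). buy P w t) = (\<Sum>t\<in>dates T (called w K). buy P w t)"
        by (rule sum_dates_mono_neutral) (use D in \<open>auto simp: dates_def\<close>)
      then show ?thesis
        by (simp add: final_shares_def C_def sum_distrib_left mult.commute)
    qed
    have cash: "C w * d * exp (r * T) \<le> final_cash r T P w"
    proof -
      have "C w * d * exp (r * T) = (\<Sum>t\<in>dates T (called w K). exp (r * T) * deposit P w t)"
        by (simp add: C_def sum_distrib_left sum_distrib_right mult_ac)
      also have "\<dots> \<le> (\<Sum>t\<in>dates T (called w K). exp (r * (T - t)) * deposit P w t)"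
        using r d calls(1)[OF w]
        by (intro sum_mono mult_right_mono_neg)
          (auto simp: dates_def mult_left_mono intro!: mult_nonpos_nonneg)
      also have "\<dots> = (\<Sum>t\<in>dates T (deposit P w). exp (r * (T - t)) * deposit P w t)"
        by (rule sum_dates_mono_neutral[symmetric]) (use D in \<open>auto simp: dates_def\<close>)
      finally show ?thesis
        by (simp add: final_cash_def)
    qed
    have euro: "(\<Sum>L\<in>positions (european P). european P L * max (L - price w T) 0) =
        (\<Sum>L\<in>F. q L * max (L - price w T) 0)"
      using sum_positions_mono_neutral[OF F(1) pos(1), of "\<lambda>L. european P L * max (L - price w T) 0"]
      by simp
    \<comment> \<open>Two separate surpluses: at every date that of hedging the calls made then, by
      \<open>call\<close>, and at \<open>T\<close> that of the liquidation, by \<open>final\<close>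
      with \<theta> equal to \<open>C w\<close>.\<close>
    have "0 \<le> ?c * ((\<Sum>L\<in>F. x L * (L - ?S)) - (K - ?S) - b * ?S - d)"
      using calls(1)[OF w t] call[OF S] by (intro mult_nonneg_nonneg) auto
    moreover have "0 \<le> (\<Sum>L\<in>F. rest w L * (L - ?S)) + terminal_value r T P w" if "t = T"
    proof -
      have "0 \<le> (\<Sum>L\<in>F. (q L + l L - C w * x L) * max (L - ?S) 0) + C w * b * ?S
          + C w * d * exp (r * T)"
        using final[OF S] calls[OF w t] by blast
      also have "(\<Sum>L\<in>F. (q L + l L - C w * x L) * max (L - ?S) 0) =
          (\<Sum>L\<in>F. rest w L * (L - ?S)) + (\<Sum>L\<in>F. q L * max (L - ?S) 0)"
        unfolding that rest_payoff sum.distrib[symmetric] by (simp add: algebra_simps)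
      also have "\<dots> + C w * b * ?S + C w * d * exp (r * T) \<le>
          (\<Sum>L\<in>F. rest w L * (L - ?S)) + terminal_value r T P w"
        using cash euro unfolding that terminal_value_def shares by linarith
      finally show ?thesis .
    qed
    ultimately show ?thesis
      by (auto simp: cashflow_def ex algebra_simps)
  qed
  ultimately show False
    using no_arb by (auto simp: model_independent_arbitrage_def)
qed

section \<open>The intrinsic value bound\<close>

text \<open>Otherwise the put and a share, bought with \<open>K\<close> borrowed, have negative
  initial value, and exercising at once, selling the share and repaying the loan closes the position
  at no cost. This is not an instance of \<open>superhedge\<close>, whose portfolio starts without
  shares and cash.\<close>

lemma american_put_ge_intrinsic_value:
  assumes T: "0 \<le> T" and no_arb: "\<not> model_independent_arbitrage r T S0 E A" and K: "0 \<le> K"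
  shows "K - S0 \<le> A K"
proof (rule ccontr)
  assume neg: "\<not> ?thesis"
  define P where "P = \<lparr>european = (\<lambda>L. 0), am_long = (\<lambda>L. if L = K then 1 else 0),
    am_short = (\<lambda>L. 0), shares = 1, cash = - K,
    buy = (\<lambda>w t. if t = 0 then - 1 else 0), deposit = (\<lambda>w t. if t = 0 then K else 0),
    exercise = (\<lambda>w L t. if L = K \<and> t = 0 then 1 else 0)\<rparr>"
  have [simp]: "european P = (\<lambda>L. 0)" "am_long P = (\<lambda>L. if L = K then 1 else 0)"
    "am_short P = (\<lambda>L. 0)" "shares P = 1" "cash P = - K"
    "buy P = (\<lambda>w t. if t = 0 then - 1 else 0)" "deposit P = (\<lambda>w t. if t = 0 then K else 0)"
    "exercise P = (\<lambda>w L t. if L = K \<and> t = 0 then 1 else 0)"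
    by (simp_all add: P_def)
  have pos: "positions (\<lambda>L. 0) = {}" "positions (\<lambda>L. if L = K then 1 else 0) = {K}"
    by (auto simp: positions_def)
  have dates_at_0: "dates T (\<lambda>t. if t = 0 then c else 0) = (if c = 0 then {} else {0})"
    "dates T (\<lambda>t. if b \<and> t = 0 then 1 else 0) = (if b then {0} else {})" for b and c :: real
    using T by (auto simp: dates_def)
  have "semi_static T S0 P"
    unfolding semi_static_def
    using K T by (auto simp: pos dates_at_0 nonanticipating_def exercise_plan_def)
  moreover have "initial_value S0 E A P < 0"
    using neg pos by (simp add: initial_value_def)
  moreover have "0 \<le> cashflow r T P w t" if "w \<in> scenarios T S0 P" for w t
  proof -
    have "terminal_value r T P w = 0"
      using pos by (simp add: terminal_value_def final_shares_def final_cash_def dates_at_0)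
    then show ?thesis
      using that pos
      by (auto simp: cashflow_def exercise_cashflow_def scenarios_def)
  qed
  ultimately show False
    using no_arb by (auto simp: model_independent_arbitrage_def)
qed

section \<open>The hedges behind the price inequalities\<close>

theorem theorem2p3:
  fixes r T S0 :: real and E A :: "real \<Rightarrow> real"
  assumes "r > 0" and "T \<ge> 0" and "S0 \<ge> 0"
    and "mono_on {0..} E" and "convex_on {0..} E" and "E 0 = 0"
    and "\<And>K. K \<ge> 0 \<Longrightarrow> E K \<ge> max (exp (- r * T) * K - S0) 0"
    and "\<And>K. K \<ge> 0 \<Longrightarrow> E K \<le> exp (- r * T) * K"
    and "\<And>K. K \<ge> 0 \<Longrightarrow> E K > exp (- r * T) * K - S0 \<Longrightarrow> right_deriv E K < exp (- r * T)"
    and "\<not> model_independent_arbitrage r T S0 E A"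
  shows "mono_on {0..} A \<and> convex_on {0..} A \<and>
    (\<forall>K\<ge>0. A differentiable (at_right K) \<and>
       right_deriv A K * K - A K \<ge> right_deriv E K * K - E K) \<and>
    (\<forall>K\<ge>0. A K \<ge> max (E K) (K - S0)) \<and>
    (\<forall>K\<ge>0. A K \<le> E (exp (r * T) * K))"
proof -
  have r: "0 \<le> r"
    using assms(1) by simp
  note superhedge = superhedge[OF r assms(2,10)]
  have mono: "mono_on {0..} A"
  proof (rule mono_onI)
    fix K L :: real assume "K \<in> {0..}" "L \<in> {0..}" "K \<le> L"
    then show "A K \<le> A L"
      \<comment> \<open>Each call is met by exercising one put with the larger strike. The arguments
        are \<open>F\<close>, \<open>K\<close>, \<open>n\<close>, \<open>d\<close>,
        \<open>x\<close>, \<open>l\<close>, \<open>b\<close>, \<open>q\<close>, in this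
        order.\<close>
      using superhedge[of "{L}" K 1 0 "\<lambda>_. 1" "\<lambda>_. 1" 0 "\<lambda>_. 0"] by simp
  qed
  have conv: "convex_on {0..} A"
  proof (rule convex_on_linorderI)
    fix t K L :: real assume t: "0 < t" "t < 1" and KL: "K \<in> {0..}" "L \<in> {0..}" "K < L"
    define l where "l M = (if M = K then 1 - t else t)" for M
    have [simp]: "l K = 1 - t" "l L = t"
      using KL by (auto simp: l_def)
    have "1 * A ((1 - t) * K + t * L) \<le> (\<Sum>M\<in>{K, L}. 0 * E M + l M * A M)"
    \<comment> \<open>Exercising \<open>l M\<close> puts of each strike \<open>M\<close> pays
      exactly what a call costs, since the strike sold is the same convex combination of
      \<open>K\<close> and \<open>L\<close>.\<close>
    proof (rule superhedge[where x = l and b = 0 and d = 0])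
      show "0 \<le> (\<Sum>M\<in>{K, L}. (0 + l M - \<theta> * l M) * max (M - S) 0) + \<theta> * 0 * S + \<theta> * 0 * exp (r * T)"
        if "0 \<le> \<theta>" "\<theta> \<le> 1" for S \<theta>
        using that t KL mult_left_le_one_le[of t \<theta>] mult_left_le_one_le[of "1 - t" \<theta>] by simp
      have "0 \<le> (1 - t) * K + t * L"
        using t KL by simp
      then show "0 \<le> (1 - t) * K + t * L" .
    qed (use t KL in \<open>auto simp: algebra_simps\<close>)
    then show "A ((1 - t) *\<^sub>R K + t *\<^sub>R L) \<le> (1 - t) * A K + t * A L"
      using KL by simp
  qed simp
  have ge_E: "E K \<le> A K" if "0 \<le> K" for K
    \<comment> \<open>No American put is sold (\<open>n = 0\<close>, dummy strike 0): a long
      American put, kept until \<open>T\<close>, covers a short European one.\<close>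
    using superhedge[of "{K}" 0 0 0 "\<lambda>_. 0" "\<lambda>_. 1" 0 "\<lambda>_. - 1"] that by simp
  have le_E: "A K \<le> E (exp (r * T) * K)" if K: "0 \<le> K" for K
  proof -
    \<comment> \<open>A call is paid with a loan of \<open>K\<close> and delivers a share. At
      \<open>T\<close> the debt per called put is at most \<open>exp (r * T) * K\<close>, the strike
      at which the European put sells that share.\<close>
    have "0 \<le> max (exp (r * T) * K - S) 0 + \<theta> * S + \<theta> * - K * exp (r * T)"
      if "0 \<le> \<theta>" "\<theta> \<le> 1" for S \<theta>
    proof -
      have "\<theta> * (exp (r * T) * K - S) \<le> \<theta> * max (exp (r * T) * K - S) 0"
        using that by (intro mult_left_mono) auto
      also have "\<dots> \<le> max (exp (r * T) * K - S) 0"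
        using that by (intro mult_left_le_one_le) auto
      finally show ?thesis
        by (simp add: algebra_simps)
    qed
    then show ?thesis
      using superhedge[of "{exp (r * T) * K}" K 1 "- K" "\<lambda>_. 0" "\<lambda>_. 0" 1 "\<lambda>_. 1"] K by simp
  qed
  have chord: "K * E (K + h) - (K + h) * E K \<le> K * A (K + h) - (K + h) * A K"
    if K: "0 \<le> K" and h: "0 < h" for K h
  proof -
    define q where "q M = (if M = K then K + h else - K)" for M
    define l where "l M = (if M = K then 0 else K)" for M
    have "(K + h) * A K \<le> (\<Sum>M\<in>{K, K + h}. q M * E M + l M * A M)"
    \<comment> \<open>A called put and \<open>h / (K + h)\<close> shares together cost exactly what
      \<open>K / (K + h)\<close> puts with strike \<open>K + h\<close> pay, so no loan is
      taken.\<close>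
    proof (rule superhedge[where x = "\<lambda>M. l M / (K + h)" and b = "h / (K + h)" and d = 0])
      fix S \<theta> :: real
      assume S: "0 \<le> S" and \<theta>: "0 \<le> \<theta>" "\<theta> \<le> K + h"
      \<comment> \<open>\<eta> is the fraction of the sold American puts that was called. The long
        ones left over cover the fraction \<open>1 - \<eta>\<close> of the short European puts, so
        \<open>\<eta> * K\<close> of these stay uncovered.\<close>
      define \<eta> where "\<eta> = \<theta> / (K + h)"
      have \<eta>: "0 \<le> \<eta>" "\<eta> \<le> 1"
        using \<theta> K h by (auto simp: \<eta>_def)
      have "\<eta> * (K * max (K + h - S) 0 - h * S) \<le> \<eta> * ((K + h) * max (K - S) 0)"
      proof (rule mult_left_mono[OF _ \<eta>(1)])
        \<comment> \<open>Up to \<open>S = K + h\<close> the shares reduce the liability to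
          \<open>(K + h) * (K - S)\<close>; for larger \<open>S\<close> there is none.\<close>
        have "K * (K + h - S) - h * S = (K + h) * (K - S)"
          by (simp add: algebra_simps)
        moreover have "(K + h) * (K - S) \<le> (K + h) * max (K - S) 0"
          using K h by (intro mult_left_mono) auto
        moreover have "0 \<le> h * S" "0 \<le> (K + h) * max (K - S) 0"
          using S K h by auto
        ultimately show "K * max (K + h - S) 0 - h * S \<le> (K + h) * max (K - S) 0"
          by (auto simp: max_def)
      qed
      also have "\<dots> \<le> (K + h) * max (K - S) 0"
        using \<eta> K h by (intro mult_left_le_one_le) auto
      finally have "0 \<le> (K + h) * max (K - S) 0 - \<eta> * K * max (K + h - S) 0 + \<eta> * h * S"
        by (simp add: algebra_simps)
      then show "0 \<le> (\<Sum>M\<in>{K, K + h}. (q M + l M - \<theta> * (l M / (K + h))) * max (M - S) 0)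
          + \<theta> * (h / (K + h)) * S + \<theta> * 0 * exp (r * T)"
        using h by (simp add: q_def l_def \<eta>_def)
    qed (use K h in \<open>auto simp: l_def field_simps\<close>)
    then show ?thesis
      using h by (simp add: q_def l_def)
  qed
  have deriv: "right_deriv E K * K - E K \<le> right_deriv A K * K - A K" if K: "0 \<le> K" for K
  proof (rule tendsto_le)
    show "at_right K \<noteq> bot"
      by (simp add: trivial_limit_at_right_real)
    show "((\<lambda>y. (A y - A K) / (y - K) * K - A K) \<longlongrightarrow> right_deriv A K * K - A K) (at_right K)"
      using convex_on_right_derivative[OF conv mono K]
      by (intro tendsto_intros) (simp add: has_field_derivative_iff)
    show "((\<lambda>y. (E y - E K) / (y - K) * K - E K) \<longlongrightarrow> right_deriv E K * K - E K) (at_right K)"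
      using convex_on_right_derivative[OF assms(5,4) K]
      by (intro tendsto_intros) (simp add: has_field_derivative_iff)
    have "(E y - E K) / (y - K) * K - E K \<le> (A y - A K) / (y - K) * K - A K" if "K < y" for y
    proof -
      \<comment> \<open>Both sides are minus the value at 0 of the line through the points of the
        graph of \<open>f\<close> at \<open>K\<close> and \<open>y\<close>; the right-hand form is
        the one that \<open>chord\<close> compares.\<close>
      have "(f y - f K) / (y - K) * K - f K = (K * f y - y * f K) / (y - K)" for f :: "real \<Rightarrow> real"
        using that by (simp add: field_simps)
      then show ?thesis
        using chord[OF K, of "y - K"] that by (simp add: divide_right_mono)
    qed
    then show "\<forall>\<^sub>F y in at_right K. (E y - E K) / (y - K) * K - E K \<le> (A y - A K) / (y - K) * K - A K"
      by (intro eventually_at_right_less[THEN eventually_mono])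
  qed
  have "A differentiable (at_right K)" if "0 \<le> K" for K
    using convex_on_right_derivative[OF conv mono that] by (auto simp: real_differentiable_def)
  then show ?thesis
    using mono conv ge_E le_E deriv american_put_ge_intrinsic_value[OF assms(2,10)] by simp
qed

end
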